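(* Let $G$ be a finite perfect POEC group with $|G|=p_1^{\alpha_1}p_2^{\alpha_2}\cdots p_k^{\alpha_k}$, where $p_1,\dots,p_k$ are distinct primes and the $\alpha_i$ are positive integers. Then $\alpha_i>1$ for all $i$.
   Context: A group $G$ is said to have the POEC property (is a POEC group) if any two elements of prime order in $G$ commute with each other (the primes may be equal or different). A group $G$ is perfect if $G=G'$, where $G'$ is its commutator subgroup. *)

theory Defs
  imports "HOL-Computational_Algebra.Primes" "HOL-Algebra.Generated_Groups" "HOL-Algebra.Multiplicative_Group"
begin

locale POEC_group = group +
  assumes prime_order_commute:
    "\<lbrakk>x \<in> carrier G; y \<in> carrier G; prime (ord x); prime (ord y)\<rbrakk> \<Longrightarrow> x \<otimes> y = y \<otimes> x"

locale perfect_group = group +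
  assumes perfect: "carrier G = derived G (carrier G)"

end

theory Submission
  imports Defs "HOL-Algebra.Sylow"
begin

text \<open>
  Suppose that a prime \<open>p\<close> divides \<open>order G\<close> exactly once. In a POEC group the elements of order
  dividing \<open>p\<close> commute, so they form a subgroup \<open>A\<close>, which contains all its conjugates. By Cauchy's
  theorem \<open>A\<close> is nontrivial and no prime other than \<open>p\<close> divides \<open>card A\<close>; nor does \<open>p\<^sup>2\<close>. Hence \<open>A\<close> is
  cyclic of order \<open>p\<close> (\<open>card_exponent_elements\<close>).

  Conjugation acts on a cyclic group by power maps, and these commute with one another. So the
  derived subgroup centralizes \<open>A\<close> (\<open>derived_centralizes_normalized_cyclic\<close>), and since \<open>G\<close> is
  perfect, \<open>A\<close> is central.

  The transfer from \<open>G\<close> into \<open>A\<close> is a homomorphism into an abelian group, hence trivial as \<open>G\<close> is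
  perfect. On a central subgroup of index \<open>m\<close> it is the map \<open>a \<mapsto> a [^] m\<close> (\<open>transfer_central\<close>), so an
  element of order \<open>p\<close> in \<open>A\<close> forces \<open>p\<close> to divide \<open>m\<close> (\<open>order_dvd_index_central\<close>). As
  \<open>order G = m * p\<close>, this makes \<open>p\<^sup>2\<close> a divisor of \<open>order G\<close>, a contradiction.
\<close>

section \<open>The transfer into an abelian subgroup\<close>

definition coset_rep :: "'a set \<Rightarrow> 'a"
  where "coset_rep C = (SOME c. c \<in> C)"

text \<open>If \<open>r C\<close> is the chosen representative of \<open>C\<close>, then \<open>r C \<otimes> g\<close> and \<open>r (C #> g)\<close> lie in the same
  right coset of \<open>H\<close>. The factor measures by which element of \<open>H\<close> they differ.\<close>

definition transfer_factor :: "('a, 'b) monoid_scheme \<Rightarrow> 'a \<Rightarrow> 'a set \<Rightarrow> 'a"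
  where "transfer_factor G g C =
    coset_rep C \<otimes>\<^bsub>G\<^esub> g \<otimes>\<^bsub>G\<^esub> inv\<^bsub>G\<^esub> coset_rep (C #>\<^bsub>G\<^esub> g)"

text \<open>The product is formed in \<open>G\<lparr>carrier := H\<rparr>\<close> because \<open>finprod\<close> needs a commutative monoid, and only
  \<open>H\<close> is going to be abelian. For infinite index the value is the default \<open>\<one>\<close>.\<close>

definition transfer :: "('a, 'b) monoid_scheme \<Rightarrow> 'a set \<Rightarrow> 'a \<Rightarrow> 'a"
  where "transfer G H g =
    finprod (G\<lparr>carrier := H\<rparr>) (transfer_factor G g) (rcosets\<^bsub>G\<^esub> H)"

context group
begin

lemma coset_rep_in_coset:
  assumes "subgroup H G" "C \<in> rcosets H"
  shows "coset_rep C \<in> C" "coset_rep C \<in> carrier G" "C = H #> coset_rep C"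
proof -
  obtain a where a: "a \<in> carrier G" "C = H #> a"
    using assms(2) by (auto simp: RCOSETS_def)
  have "a \<in> C"
    using a rcos_self assms(1) by blast
  then show *: "coset_rep C \<in> C"
    unfolding coset_rep_def by (rule someI)
  then show "coset_rep C \<in> carrier G"
    using a assms(1) subgroup.subset r_coset_subset_G by blast
  show "C = H #> coset_rep C"
    using repr_independence[OF _ a(1) assms(1)] * a(2) by blast
qed

lemma rcoset_translate_closed:
  assumes "subgroup H G" "C \<in> rcosets H" "g \<in> carrier G"
  shows "C #> g \<in> rcosets H"
proof -
  obtain a where a: "a \<in> carrier G" "C = H #> a"
    using assms(2) by (auto simp: RCOSETS_def)
  then have "C #> g = H #> (a \<otimes> g)"
    using coset_mult_assoc assms subgroup.subset by blast
  then show ?thesis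
    using a assms rcosetsI subgroup.subset by (metis m_closed)
qed

lemma bij_betw_rcoset_translate:
  assumes "subgroup H G" "g \<in> carrier G"
  shows "bij_betw (\<lambda>C. C #> g) (rcosets H) (rcosets H)"
proof (rule bij_betw_byWitness[where f' = "\<lambda>C. C #> inv g"])
  have sub: "C \<subseteq> carrier G" if "C \<in> rcosets H" for C
    using that assms(1) subgroup.rcosets_carrier is_group by blast
  show "\<forall>C\<in>rcosets H. C #> g #> inv g = C" "\<forall>C\<in>rcosets H. C #> inv g #> g = C"
    using sub assms by (auto simp: coset_mult_assoc)
qed (use assms rcoset_translate_closed in auto)

lemma transfer_factor_closed:
  assumes "subgroup H G" "C \<in> rcosets H" "g \<in> carrier G"
  shows "transfer_factor G g C \<in> H"
proof -
  let ?D = "C #> g"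
  have D: "?D \<in> rcosets H"
    using assms rcoset_translate_closed by blast
  have "coset_rep C \<otimes> g \<in> ?D"
    using coset_rep_in_coset(1)[OF assms(1,2)] by (auto simp: r_coset_def)
  then have "coset_rep C \<otimes> g \<in> H #> coset_rep ?D"
    using coset_rep_in_coset(3)[OF assms(1) D] by simp
  then show ?thesis
    unfolding transfer_factor_def
    using subgroup.rcos_module_imp[OF assms(1) is_group coset_rep_in_coset(2)[OF assms(1) D]]
    by blast
qed

text \<open>The cocycle identity: passing from \<open>C\<close> to \<open>C #> g #> k\<close> in two steps, the representative of the
  intermediate coset cancels.\<close>

lemma transfer_factor_mult:
  assumes "subgroup H G" "C \<in> rcosets H" "g \<in> carrier G" "k \<in> carrier G"
  shows "transfer_factor G (g \<otimes> k) C =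
    transfer_factor G g C \<otimes> transfer_factor G k (C #> g)"
proof -
  have D: "C #> g \<in> rcosets H" and E: "C #> g #> k \<in> rcosets H"
    using assms rcoset_translate_closed by blast+
  have "C \<subseteq> carrier G"
    using assms subgroup.rcosets_carrier is_group by blast
  then have eq: "C #> (g \<otimes> k) = C #> g #> k"
    using assms by (simp add: coset_mult_assoc)
  let ?r = "coset_rep C" and ?s = "coset_rep (C #> g)" and ?t = "coset_rep (C #> g #> k)"
  have r: "?r \<in> carrier G" "?s \<in> carrier G" "?t \<in> carrier G"
    using coset_rep_in_coset(2)[OF assms(1)] assms(2) D E by auto
  have "?r \<otimes> (g \<otimes> k) \<otimes> inv ?t = ?r \<otimes> g \<otimes> (inv ?s \<otimes> ?s) \<otimes> k \<otimes> inv ?t"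
    using r assms by (simp add: m_assoc)
  also have "\<dots> = (?r \<otimes> g \<otimes> inv ?s) \<otimes> (?s \<otimes> k \<otimes> inv ?t)"
    by (simp only: r assms m_assoc m_closed inv_closed)
  finally show ?thesis
    by (simp add: transfer_factor_def eq)
qed

text \<open>The product over all cosets of the cocycle identity: in its second factor the cosets are permuted
  by translation with \<open>g\<close>, which does not change a product in an abelian group.\<close>

theorem transfer_hom:
  assumes H: "subgroup H G" and comm: "comm_group (G\<lparr>carrier := H\<rparr>)"
  shows "transfer G H \<in> hom G (G\<lparr>carrier := H\<rparr>)"
proof (rule homI)
  interpret A: comm_group "G\<lparr>carrier := H\<rparr>"
    by (rule comm)
  fix g assume g: "g \<in> carrier G"
  show "transfer G H g \<in> carrier (G\<lparr>carrier := H\<rparr>)"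
    unfolding transfer_def using transfer_factor_closed[OF H _ g]
    by (intro A.finprod_closed) auto
  fix k assume k: "k \<in> carrier G"
  let ?P = "finprod (G\<lparr>carrier := H\<rparr>)"
  have bij: "inj_on (\<lambda>C. C #> g) (rcosets H)" "(\<lambda>C. C #> g) ` (rcosets H) = rcosets H"
    using bij_betw_rcoset_translate[OF H g] by (auto simp: bij_betw_def)
  have "transfer G H (g \<otimes> k) =
      ?P (\<lambda>C. transfer_factor G g C \<otimes>\<^bsub>G\<lparr>carrier := H\<rparr>\<^esub> transfer_factor G k (C #> g)) (rcosets H)"
    unfolding transfer_def
    by (rule A.finprod_cong')
      (use transfer_factor_mult[OF H _ g k] transfer_factor_closed[OF H] g k
        rcoset_translate_closed[OF H _ g] subgroup.m_closed[OF H] in auto)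
  also have "\<dots> = transfer G H g \<otimes>\<^bsub>G\<lparr>carrier := H\<rparr>\<^esub> ?P (\<lambda>C. transfer_factor G k (C #> g)) (rcosets H)"
    unfolding transfer_def
    using transfer_factor_closed[OF H] rcoset_translate_closed[OF H _ g] g k
    by (intro A.finprod_multf) auto
  also have "?P (\<lambda>C. transfer_factor G k (C #> g)) (rcosets H) = transfer G H k"
    unfolding transfer_def
    using A.finprod_reindex[of "transfer_factor G k" "\<lambda>C. C #> g" "rcosets H"]
      bij transfer_factor_closed[OF H _ k] by auto
  finally show "transfer G H (g \<otimes> k) = transfer G H g \<otimes>\<^bsub>G\<lparr>carrier := H\<rparr>\<^esub> transfer G H k" .
qed

text \<open>Translation by a central \<open>z\<close> in \<open>H\<close> fixes every coset, so every factor equals \<open>z\<close>. For infinite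
  index both sides are \<open>\<one>\<close>, since then \<open>card\<close> is \<open>0\<close>.\<close>

lemma transfer_central:
  assumes H: "subgroup H G" and comm: "comm_group (G\<lparr>carrier := H\<rparr>)"
    and z: "z \<in> H" and central: "\<And>g. g \<in> carrier G \<Longrightarrow> g \<otimes> z = z \<otimes> g"
  shows "transfer G H z = z [^] card (rcosets H)"
proof -
  interpret A: comm_group "G\<lparr>carrier := H\<rparr>"
    by (rule comm)
  have zG: "z \<in> carrier G"
    by (rule subgroup.mem_carrier[OF H z])
  have "transfer_factor G z C = z" if C: "C \<in> rcosets H" for C
  proof -
    note r = coset_rep_in_coset[OF H C]
    have "C #> z = H #> coset_rep C #> z"
      by (simp flip: r(3))
    also have "\<dots> = H #> z #> coset_rep C"
      using r(2) zG subgroup.subset[OF H] central by (simp add: coset_mult_assoc)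
    also have "\<dots> = C"
      by (simp add: coset_join2[OF zG H z] flip: r(3))
    finally show ?thesis
      using r(2) zG central[OF r(2)] by (simp add: transfer_factor_def m_assoc)
  qed
  then have "transfer G H z = finprod (G\<lparr>carrier := H\<rparr>) (\<lambda>C. z) (rcosets H)"
    unfolding transfer_def by (intro A.finprod_cong') (use z in auto)
  also have "\<dots> = z [^] card (rcosets H)"
    using A.finprod_const[of z] z by (simp flip: nat_pow_consistent)
  finally show ?thesis .
qed

section \<open>Perfect groups\<close>

text \<open>If \<open>g\<close> and \<open>h\<close> conjugate \<open>x\<close> to \<open>x [^] i\<close> and \<open>x [^] j\<close>, then \<open>g \<otimes> h\<close> and \<open>h \<otimes> g\<close> both conjugate it to
  \<open>x [^] (i * j)\<close>, so they differ by an element of the centralizer of \<open>x\<close>.\<close>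

lemma derived_centralizes_normalized_cyclic:
  assumes x: "x \<in> carrier G"
    and norm: "\<And>g. g \<in> carrier G \<Longrightarrow> \<exists>i::nat. g \<otimes> x = x [^] i \<otimes> g"
  shows "derived G (carrier G) \<subseteq> {c \<in> carrier G. c \<otimes> x = x \<otimes> c}" (is "_ \<subseteq> ?C")
proof -
  have sub: "subgroup ?C G"
  proof (rule subgroupI)
    fix c assume c: "c \<in> ?C"
    then have cG: "c \<in> carrier G" and cx: "c \<otimes> x = x \<otimes> c"
      by auto
    have "inv c \<otimes> x = inv c \<otimes> (x \<otimes> c) \<otimes> inv c"
      using cG x by (simp add: m_assoc)
    also have "\<dots> = (inv c \<otimes> c) \<otimes> x \<otimes> inv c"
      by (simp only: cx[symmetric] m_assoc cG x inv_closed m_closed)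
    finally show "inv c \<in> ?C"
      using cG x by simp
  next
    fix c d assume "c \<in> ?C" "d \<in> ?C"
    then show "c \<otimes> d \<in> ?C"
      using x by (auto simp: m_assoc) (metis m_assoc)
  qed (use x in auto)
  have pow: "g \<otimes> x [^] (j::nat) = x [^] (i * j) \<otimes> g"
    if g: "g \<in> carrier G" and i: "g \<otimes> x = x [^] i \<otimes> g" for g and i j :: nat
  proof (induction j)
    case (Suc j)
    have "g \<otimes> x [^] Suc j = (g \<otimes> x [^] j) \<otimes> x"
      using g x by (simp add: m_assoc)
    also have "\<dots> = x [^] (i * j) \<otimes> (g \<otimes> x)"
      using Suc g x by (simp add: m_assoc)
    also have "\<dots> = x [^] (i * Suc j) \<otimes> g"
      using i g x by (simp add: nat_pow_mult add.commute flip: m_assoc)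
    finally show ?case .
  qed (use g in simp)
  have "g \<otimes> h \<otimes> inv g \<otimes> inv h \<in> ?C" if g: "g \<in> carrier G" and h: "h \<in> carrier G" for g h
  proof -
    \<comment> \<open>For the inverses, the commutator sits on the right: \<open>h' \<otimes> g' \<otimes> c = g' \<otimes> h'\<close>. Cancelling
      \<open>h' \<otimes> g'\<close> on the left then yields \<open>c \<otimes> x = x \<otimes> c\<close> itself; with the commutator on the left
      only its commuting with \<open>x [^] (i * j)\<close> would come out.\<close>
    define g' h' c where "g' = inv g" and "h' = inv h" and "c = g \<otimes> h \<otimes> inv g \<otimes> inv h"
    have carr: "g' \<in> carrier G" "h' \<in> carrier G" "c \<in> carrier G"
      using g h by (auto simp: g'_def h'_def c_def)
    have swap: "h' \<otimes> g' \<otimes> c = g' \<otimes> h'"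
    proof -
      have "h' \<otimes> g' \<otimes> c = inv (g \<otimes> h) \<otimes> ((g \<otimes> h) \<otimes> (inv g \<otimes> inv h))"
        using g h by (simp add: c_def g'_def h'_def inv_mult_group m_assoc)
      also have "\<dots> = g' \<otimes> h'"
        using g h by (simp add: g'_def h'_def inv_solve_left' del: inv_mult_group)
      finally show ?thesis .
    qed
    obtain i j :: nat where i: "g' \<otimes> x = x [^] i \<otimes> g'" and j: "h' \<otimes> x = x [^] j \<otimes> h'"
      using norm carr by blast
    have gh: "g' \<otimes> h' \<otimes> x = x [^] (i * j) \<otimes> (g' \<otimes> h')"
    proof -
      have "g' \<otimes> h' \<otimes> x = (g' \<otimes> x [^] j) \<otimes> h'"
        using j carr x by (simp add: m_assoc)
      then show ?thesis
        using pow[OF carr(1) i, of j] carr x by (simp add: m_assoc)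
    qed
    have hg: "h' \<otimes> g' \<otimes> x = x [^] (i * j) \<otimes> (h' \<otimes> g')"
    proof -
      have "h' \<otimes> g' \<otimes> x = (h' \<otimes> x [^] i) \<otimes> g'"
        using i carr x by (simp add: m_assoc)
      then show ?thesis
        using pow[OF carr(2) j, of i] carr x by (simp add: m_assoc mult.commute)
    qed
    have "(h' \<otimes> g') \<otimes> (c \<otimes> x) = x [^] (i * j) \<otimes> (h' \<otimes> g' \<otimes> c)"
      using gh swap carr x by (simp flip: m_assoc)
    also have "\<dots> = (h' \<otimes> g') \<otimes> (x \<otimes> c)"
      using hg carr x by (metis m_assoc m_closed nat_pow_closed)
    finally have "c \<otimes> x = x \<otimes> c"
      using carr x by simp
    then show ?thesis
      using carr by (simp add: c_def)
  qed
  then have "derived_set G (carrier G) \<subseteq> ?C"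
    by auto
  then show ?thesis
    unfolding derived_def using generate_subgroup_incl[OF _ sub] by blast
qed

end

lemma (in perfect_group) hom_to_comm_group_trivial:
  assumes "f \<in> hom G K" "comm_group K" "g \<in> carrier G"
  shows "f g = \<one>\<^bsub>K\<^esub>"
proof -
  interpret K: comm_group K
    by (rule assms)
  interpret group_hom G K f
    using assms(1) by unfold_locales
  \<comment> \<open>The image of a perfect group is perfect, but inside an abelian group it has trivial derived
    subgroup.\<close>
  have "f ` carrier G = derived K (f ` carrier G)"
    using perfect derived_img[of "carrier G"] by auto
  also have "\<dots> = {\<one>\<^bsub>K\<^esub>}"
    by (rule K.derived_eq_singleton) auto
  finally show ?thesis
    using assms(3) by blast
qed

text \<open>The transfer into \<open>H\<close> sends \<open>z\<close> to its power by the index, and it is trivial because the group is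
  perfect.\<close>

lemma (in perfect_group) order_dvd_index_central:
  assumes H: "subgroup H G" and z: "z \<in> H"
    and central: "\<And>g h. g \<in> carrier G \<Longrightarrow> h \<in> H \<Longrightarrow> g \<otimes> h = h \<otimes> g"
  shows "ord z dvd card (rcosets H)"
proof -
  have comm: "comm_group (G\<lparr>carrier := H\<rparr>)"
    using central subgroup.mem_carrier[OF H]
    by (intro group.group_comm_groupI subgroup.subgroup_is_group[OF H] is_group) auto
  have zG: "z \<in> carrier G"
    by (rule subgroup.mem_carrier[OF H z])
  have "z [^] card (rcosets H) = transfer G H z"
    by (rule transfer_central[OF H comm z, symmetric]) (rule central[OF _ z])
  also have "\<dots> = \<one>"
    using hom_to_comm_group_trivial[OF transfer_hom[OF H comm] comm zG] by simp
  finally have "z [^] card (rcosets H) = \<one>" .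
  then show ?thesis
    using zG pow_eq_id by blast
qed

section \<open>Elements of order dividing a prime in a POEC group\<close>

text \<open>Sylow's theorem yields subgroups of every prime power order dividing the group order; here the
  exponent \<open>1\<close> is used.\<close>

lemma (in group) Cauchy:
  assumes "finite (carrier G)" "Factorial_Ring.prime p" "p dvd order G"
  shows "\<exists>x\<in>carrier G. ord x = p"
proof -
  obtain m where "order G = p ^ 1 * m"
    using assms(3) by auto
  then obtain H where H: "subgroup H G" "card H = p"
    using sylow_thm[OF assms(2) is_group _ assms(1)] by fastforce
  have "H \<noteq> {\<one>}"
    using H assms(2) by auto
  then obtain x where x: "x \<in> H" "x \<noteq> \<one>"
    using H(1) subgroup.one_closed by blast
  have xG: "x \<in> carrier G"
    by (rule subgroup.mem_carrier[OF H(1) x(1)])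
  interpret K: group "G\<lparr>carrier := H\<rparr>"
    by (rule subgroup.subgroup_is_group[OF H(1) is_group])
  have "x [^] p = \<one>"
    using K.pow_order_eq_1[of x] x H by (simp add: order_def flip: nat_pow_consistent)
  then have "ord x dvd p"
    using xG pow_eq_id by blast
  then show ?thesis
    using xG x ord_eq_1 assms(2) by (metis prime_nat_iff)
qed

definition (in group) exponent_elements :: "nat \<Rightarrow> 'a set"
  where "exponent_elements p = {x \<in> carrier G. x [^] p = \<one>}"

context POEC_group
begin

lemma exponent_elements_commute:
  assumes p: "Factorial_Ring.prime p" and "x \<in> exponent_elements p" "y \<in> exponent_elements p"
  shows "x \<otimes> y = y \<otimes> x"
proof -
  have *: "z = \<one> \<or> ord z = p" if "z \<in> exponent_elements p" for z
  proof -
    have z: "z \<in> carrier G" "ord z dvd p"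
      using that pow_eq_id by (auto simp: exponent_elements_def)
    then have "ord z = 1 \<or> ord z = p"
      using p by (simp add: prime_nat_iff)
    then show ?thesis
      using ord_eq_1[OF z(1)] by blast
  qed
  have "x \<in> carrier G" "y \<in> carrier G"
    using assms by (auto simp: exponent_elements_def)
  then show ?thesis
    using *[OF assms(2)] *[OF assms(3)] p prime_order_commute by auto
qed

text \<open>Closure under multiplication is where the POEC property enters: \<open>(x \<otimes> y) [^] p\<close> splits only because
  \<open>x\<close> and \<open>y\<close> commute.\<close>

lemma exponent_elements_subgroup:
  assumes p: "Factorial_Ring.prime p"
  shows "subgroup (exponent_elements p) G"
proof (rule subgroupI)
  show "exponent_elements p \<noteq> {}"
    by (auto simp: exponent_elements_def)
next
  fix x y assume xy: "x \<in> exponent_elements p" "y \<in> exponent_elements p"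
  then show "x \<otimes> y \<in> exponent_elements p"
    using exponent_elements_commute[OF p xy]
    by (auto simp: exponent_elements_def pow_mult_distrib)
qed (auto simp: exponent_elements_def nat_pow_inv)

text \<open>A group of exponent \<open>p\<close> has no element of another prime order, so by Cauchy's theorem its order is
  a power of \<open>p\<close>. It is not \<open>1\<close> because \<open>G\<close> has an element of order \<open>p\<close>, and it is not
  divisible by \<open>p\<^sup>2\<close> because \<open>order G\<close> is not.\<close>

lemma card_exponent_elements:
  assumes fin: "finite (carrier G)" and p: "Factorial_Ring.prime p"
    and dvd: "p dvd order G" and sq: "\<not> p\<^sup>2 dvd order G"
  shows "card (exponent_elements p) = p"
proof -
  let ?A = "exponent_elements p" and ?K = "G\<lparr>carrier := exponent_elements p\<rparr>"
  note A = exponent_elements_subgroup[OF p]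
  interpret K: group ?K
    by (rule subgroup.subgroup_is_group[OF A is_group])
  have finA: "finite ?A"
    using fin A finite_subset subgroup.subset by blast
  have pow: "x [^]\<^bsub>?K\<^esub> p = \<one>" if "x \<in> ?A" for x
    using that by (simp add: exponent_elements_def flip: nat_pow_consistent)
  have only_p: "q = p" if q: "Factorial_Ring.prime q" "q dvd card ?A" for q
  proof -
    have "\<exists>x\<in>?A. K.ord x = q"
      using K.Cauchy[OF _ q(1)] q(2) finA by (simp add: order_def)
    then obtain x where x: "x \<in> ?A" "K.ord x = q"
      by blast
    then have "q dvd p"
      using pow[OF x(1)] K.pow_eq_id[of x p] by simp
    then show "q = p"
      using q(1) p primes_dvd_imp_eq by blast
  qed
  obtain x where x: "x \<in> carrier G" "ord x = p"
    using Cauchy[OF fin p dvd] by blast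
  have xA: "x \<in> ?A"
    using x pow_ord_eq_1[of x] by (auto simp: exponent_elements_def)
  have "K.ord x dvd p" "K.ord x \<noteq> 1"
    using K.pow_eq_id[of x p] pow[OF xA] K.ord_eq_1[of x] ord_eq_1[of x] x xA p by auto
  then have "K.ord x = p"
    using p unfolding prime_nat_iff by blast
  moreover have "K.ord x dvd card ?A"
    using K.ord_dvd_group_order[of x] xA by (simp add: order_def)
  ultimately obtain c where c: "card ?A = p * c"
    by auto
  have "c = 1"
  proof (rule ccontr)
    assume "c \<noteq> 1"
    then obtain q where q: "Factorial_Ring.prime q" "q dvd c"
      using prime_factor_nat by blast
    then have "p dvd c"
      using only_p[of q] c by simp
    then have "p\<^sup>2 dvd card ?A"
      by (simp add: c power2_eq_square)
    moreover have "card ?A dvd order G"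
      using lagrange[OF A] by (metis dvd_triv_right)
    ultimately show False
      using sq dvd_trans by blast
  qed
  with c show ?thesis
    by simp
qed

end

text \<open>The subgroup of elements of order dividing \<open>p\<close> is first shown to be generated by one element \<open>x\<close> of
  order \<open>p\<close>; being invariant under conjugation in a perfect group, it is then
  central, and the transfer applies.\<close>

lemma perfect_POEC_prime_square_dvd:
  fixes G (structure)
  assumes fin: "finite (carrier G)" and "perfect_group G" "POEC_group G"
    and p: "Factorial_Ring.prime p" and dvd: "p dvd order G"
  shows "p\<^sup>2 dvd order G"
proof (rule ccontr)
  assume sq: "\<not> p\<^sup>2 dvd order G"
  interpret perfect_group G
    by fact
  interpret POEC_group G
    by fact
  let ?A = "exponent_elements p"
  note A = exponent_elements_subgroup[OF p]
  have card: "card ?A = p"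
    using card_exponent_elements[OF fin p dvd sq] .
  obtain x where x: "x \<in> carrier G" "ord x = p"
    using Cauchy[OF fin p dvd] by blast
  have xA: "x \<in> ?A"
    using x pow_ord_eq_1[of x] by (auto simp: exponent_elements_def)
  have "generate G {x} \<subseteq> ?A"
    using generate_subgroup_incl[OF _ A] xA by blast
  moreover have "card (generate G {x}) = card ?A"
    using generate_pow_card[OF x(1)] x(2) card by simp
  moreover have "finite ?A"
    using card p by (metis card.infinite not_prime_0)
  ultimately have "?A = generate G {x}"
    by (metis card_subset_eq)
  moreover have "generate G {x} = {x [^] i | i. i \<in> (UNIV :: nat set)}"
    using generate_pow_nat[OF x(1)] x p by (simp add: prime_gt_0_nat)
  ultimately have A_pow: "\<exists>i::nat. a = x [^] i" if "a \<in> ?A" for a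
    using that by auto
  have "\<exists>i::nat. g \<otimes> x = x [^] i \<otimes> g" if g: "g \<in> carrier G" for g
  proof -
    have "(g \<otimes> x \<otimes> inv g) [^] (n::nat) = g \<otimes> x [^] n \<otimes> inv g" for n
    proof (induction n)
      case (Suc n)
      then show ?case
        using g x by (simp add: m_assoc inv_solve_left')
    qed (use g in simp)
    then have "g \<otimes> x \<otimes> inv g \<in> ?A"
      using g xA by (auto simp: exponent_elements_def)
    then obtain i :: nat where "g \<otimes> x \<otimes> inv g = x [^] i"
      using A_pow by blast
    then have "g \<otimes> x = x [^] i \<otimes> g"
      using g x by (metis inv_solve_right' m_closed nat_pow_closed)
    then show ?thesis
      by blast
  qed
  then have gx: "g \<otimes> x = x \<otimes> g" if "g \<in> carrier G" for g
    using derived_centralizes_normalized_cyclic[OF x(1)] perfect that by blast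
  have central: "g \<otimes> a = a \<otimes> g" if "g \<in> carrier G" "a \<in> ?A" for g a
  proof -
    obtain i :: nat where "a = x [^] i"
      using A_pow \<open>a \<in> ?A\<close> by blast
    then show ?thesis
      using group_commutes_pow[of x g i] gx that x by simp
  qed
  have "p dvd card (rcosets ?A)"
    using order_dvd_index_central[OF A xA central] x by simp
  then have "p * p dvd order G"
    using lagrange[OF A] card by (metis dvd_refl mult_dvd_mono)
  with sq show False
    by (simp add: power2_eq_square)
qed

theorem corollary2p15:
  fixes G :: "('a, 'b) monoid_scheme" and p \<alpha> :: "nat \<Rightarrow> nat" and k :: nat
  assumes "finite (carrier G)"
    and "perfect_group G"
    and "POEC_group G"
    and "order G = (\<Prod>i = 1..k. p i ^ \<alpha> i)"
    and "\<And>i. i \<in> {1..k} \<Longrightarrow> Factorial_Ring.prime (p i)"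
    and "inj_on p {1..k}"
    and "\<And>i. i \<in> {1..k} \<Longrightarrow> \<alpha> i > 0"
  shows "\<forall>i \<in> {1..k}. \<alpha> i > 1"
proof (intro ballI, rule ccontr)
  fix i assume i: "i \<in> {1..k}" and "\<not> \<alpha> i > 1"
  then have \<alpha>: "\<alpha> i = 1"
    using assms(7)[OF i] by simp
  define r where "r = (\<Prod>j \<in> {1..k} - {i}. p j ^ \<alpha> j)"
  have order: "order G = p i * r"
    using assms(4) prod.remove[OF _ i, of "\<lambda>j. p j ^ \<alpha> j"] \<alpha> by (simp add: r_def)
  then have "(p i)\<^sup>2 dvd p i * r"
    using perfect_POEC_prime_square_dvd[OF assms(1-3) assms(5)[OF i]] by simp
  then have "p i dvd r"
    using assms(5)[OF i] by (simp add: power2_eq_square)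
  then obtain j where j: "j \<in> {1..k} - {i}" "p i dvd p j ^ \<alpha> j"
    using assms(5)[OF i] prime_dvd_prod_iff[of "{1..k} - {i}" "p i" "\<lambda>j. p j ^ \<alpha> j"]
    unfolding r_def by blast
  then have "p i = p j"
    using assms(5)[OF i] assms(5)[of j] prime_dvd_power primes_dvd_imp_eq by blast
  then show False
    using assms(6) i j by (auto dest: inj_onD)
qed

end
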